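(* Consider the PDBO iterates $(x^t,y^t)_{t\ge 0}$ (defined in the context) generated from $F:\{0,1\}^n\to\mathbb{R}$ with multilinear extension $f$, a binarity constraint function $g$, an initial point $(x^0,y^0)\in[0,1]^n\times\mathbb{R}_{>0}^n$, step sizes $\alpha,\beta>0$ and tolerance $\delta\in(0,\tfrac12)$. Let $y^*\in\mathbb{R}^n$ be the limit of the convergent sequence $(y^t)_{t\ge0}$. Then for every $\epsilon>0$, the number of iterations needed for the algorithm to produce an iterate $x^t$ that is an $\epsilon$-binary point is bounded by $$\mathcal{O}\!\left(\frac{\|y^0-y^*\|_1}{\beta\,\epsilon}\right),$$ i.e. there is an absolute constant $C>0$ (independent of all the data above and of $\epsilon$) such that some index $t\le C\,\|y^0-y^*\|_1/(\beta\epsilon)$ has $x^t$ an $\epsilon$-binary point.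
   Context: Multilinear extension: for $F:\{0,1\}^n\to\mathbb{R}$, $f(x)=\sum_{\xi\in\{0,1\}^n} P_x(\xi)F(\xi)$, where $P_x(\xi)=\prod_{i=1}^n x_i^{\xi_i}(1-x_i)^{1-\xi_i}$ (with $0^0=1$). It is a polynomial, so its gradient is defined everywhere on $[0,1]^n$. Binarity constraint function: $g:[0,1]\to\mathbb{R}$ such that (i) $g$ is convex and continuous on $[0,1]$ with $g(0)=g(1)=0$; (ii) $g$ is differentiable on $(0,1)$, and $g'(x)=0$ if and only if $x=\tfrac12$; (iii) $g(x)=g(1-x)$ for all $x\in[0,1]$. At the endpoints, $g'(0)$ and $g'(1)$ denote the one-sided derivatives in $[-\infty,+\infty]$, with the convention $0\cdot(\pm\infty)=0$. Lagrangian: $L(x,y)=f(x)+\sum_{i=1}^n y_i g(x_i)$, so $\frac{\partial}{\partial x_i}L(x,y)=\frac{\partial f}{\partial x_i}(x)+y_i g'(x_i)$. PDBO iterates: given $(x^0,y^0)\in[0,1]^n\times\mathbb{R}^n_{>0}$, step sizes $\alpha,\beta>0$ and tolerance $\delta$, for $t=0,1,2,\dots$ and each $i\in\{1,\dots,n\}$ set: - if $|x_i^t-\frac12|\le\delta$ and $\left|\frac{\partial}{\partial x_i}L(x^t,y^t)\right|\le 2\delta$ and $y_i^t\le 0$, then $x_i^{t+1}=\frac12-\delta$ if $x_i^t\le\frac12$, and $x_i^{t+1}=\frac12+\delta$ otherwise; - else $x_i^{t+1}=\Pi_{[0,1]}\left(x_i^t-\alpha\frac{\partial}{\partial x_i}L(x^t,y^t)\right)$,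 where $\Pi_{[0,1]}$ is projection onto $[0,1]$ (sending $-\infty$ to $0$ and $+\infty$ to $1$); - in both cases $y_i^{t+1}=y_i^t+\beta\, g(x_i^t)$. The iteration is run indefinitely (no cap on the number of iterations). $\epsilon$-binary point: $x\in[0,1]^n$ is an $\epsilon$-binary point if $-\sum_{i=1}^n g(x_i)\le\epsilon$. *)

theory Defs
  imports "HOL-Analysis.Analysis"
begin

text \<open>
  Since the constant in the complexity bound must not depend on the dimension \<open>n\<close>, the dimension is
  a natural number and not an index type. A vector of length \<open>n\<close> is a function on \<open>nat\<close> of which only
  the coordinates in \<open>{1..n}\<close> are relevant. Functions on \<open>[0,1]\<close> are total functions on the reals that
  are only constrained and used on \<open>{0..1}\<close>.
\<close>

definition unit_cube :: "nat \<Rightarrow> (nat \<Rightarrow> real) set" where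
  "unit_cube n = {x. \<forall>i\<in>{1..n}. x i \<in> {0..1}}"

definition binary_cube :: "nat \<Rightarrow> (nat \<Rightarrow> nat) set" where
  "binary_cube n = ({1..n} \<rightarrow>\<^sub>E {0, 1})"

definition multilinear_ext :: "nat \<Rightarrow> ((nat \<Rightarrow> nat) \<Rightarrow> real) \<Rightarrow> (nat \<Rightarrow> real) \<Rightarrow> real" where
  "multilinear_ext n F x =
     (\<Sum>\<xi>\<in>binary_cube n. (\<Prod>i=1..n. x i ^ \<xi> i * (1 - x i) ^ (1 - \<xi> i)) * F \<xi>)"

definition partial_deriv :: "((nat \<Rightarrow> real) \<Rightarrow> real) \<Rightarrow> nat \<Rightarrow> (nat \<Rightarrow> real) \<Rightarrow> real" where
  "partial_deriv f i x = deriv (\<lambda>s. f (x(i := s))) (x i)"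

definition binarity_constraint :: "(real \<Rightarrow> real) \<Rightarrow> bool" where
  "binarity_constraint g \<longleftrightarrow>
     convex_on {0..1} g \<and> continuous_on {0..1} g \<and> g 0 = 0 \<and> g 1 = 0 \<and>
     (\<forall>x\<in>{0<..<1}. g differentiable (at x) \<and> (deriv g x = 0 \<longleftrightarrow> x = 1/2)) \<and>
     (\<forall>x\<in>{0..1}. g x = g (1 - x))"

text \<open>The derivative of \<open>g\<close> on \<open>[0,1]\<close>. The one-sided derivatives at the endpoints are limits taken in
  the extended reals; for convex \<open>g\<close> the difference quotients are monotone, so these limits exist.\<close>

definition ext_deriv :: "(real \<Rightarrow> real) \<Rightarrow> real \<Rightarrow> ereal" where
  "ext_deriv g x =
     (if x = 0 then Lim (at_right 0) (\<lambda>s. ereal ((g s - g 0) / (s - 0)))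
      else if x = 1 then Lim (at_left 1) (\<lambda>s. ereal ((g s - g 1) / (s - 1)))
      else ereal (deriv g x))"

definition lagrangian ::
  "nat \<Rightarrow> ((nat \<Rightarrow> nat) \<Rightarrow> real) \<Rightarrow> (real \<Rightarrow> real) \<Rightarrow> (nat \<Rightarrow> real) \<Rightarrow> (nat \<Rightarrow> real) \<Rightarrow> real" where
  "lagrangian n F g x y = multilinear_ext n F x + (\<Sum>i=1..n. y i * g (x i))"

text \<open>The \<open>i\<close>-th partial derivative of the Lagrangian in \<open>x\<close>, extended to the boundary of the cube;
  multiplication on \<^typ>\<open>ereal\<close> satisfies \<open>0 * \<plusminus>\<infinity> = 0\<close>. Lemma \<open>partial_lagrangian_interior\<close> below shows
  that it is the ordinary partial derivative where \<open>x i\<close> is in the open interval.\<close>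

definition partial_lagrangian ::
  "nat \<Rightarrow> ((nat \<Rightarrow> nat) \<Rightarrow> real) \<Rightarrow> (real \<Rightarrow> real) \<Rightarrow> nat \<Rightarrow> (nat \<Rightarrow> real) \<Rightarrow> (nat \<Rightarrow> real) \<Rightarrow> ereal" where
  "partial_lagrangian n F g i x y =
     ereal (partial_deriv (multilinear_ext n F) i x) + ereal (y i) * ext_deriv g (x i)"

definition proj01 :: "ereal \<Rightarrow> real" where
  "proj01 z = real_of_ereal (max 0 (min 1 z))"

definition pdbo_iterates ::
  "nat \<Rightarrow> ((nat \<Rightarrow> nat) \<Rightarrow> real) \<Rightarrow> (real \<Rightarrow> real) \<Rightarrow> real \<Rightarrow> real \<Rightarrow> real \<Rightarrow>
   (nat \<Rightarrow> nat \<Rightarrow> real) \<Rightarrow> (nat \<Rightarrow> nat \<Rightarrow> real) \<Rightarrow> bool" where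
  "pdbo_iterates n F g \<alpha> \<beta> \<delta> x y \<longleftrightarrow>
     (\<forall>t. \<forall>i\<in>{1..n}.
        x (Suc t) i =
          (if \<bar>x t i - 1/2\<bar> \<le> \<delta> \<and> \<bar>partial_lagrangian n F g i (x t) (y t)\<bar> \<le> ereal (2 * \<delta>) \<and> y t i \<le> 0
           then (if x t i \<le> 1/2 then 1/2 - \<delta> else 1/2 + \<delta>)
           else proj01 (ereal (x t i) - ereal \<alpha> * partial_lagrangian n F g i (x t) (y t))) \<and>
        y (Suc t) i = y t i + \<beta> * g (x t i))"

definition eps_binary :: "nat \<Rightarrow> (real \<Rightarrow> real) \<Rightarrow> real \<Rightarrow> (nat \<Rightarrow> real) \<Rightarrow> bool" where
  "eps_binary n g \<epsilon> x \<longleftrightarrow> x \<in> unit_cube n \<and> - (\<Sum>i=1..n. g (x i)) \<le> \<epsilon>"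

lemma multilinear_ext_differentiable:
  "(\<lambda>s. multilinear_ext n F (x(i := s))) differentiable (at a)"
proof -
  have "(\<lambda>s. (\<Prod>j=1..n. (x(i := s)) j ^ \<xi> j * (1 - (x(i := s)) j) ^ (1 - \<xi> j))) differentiable (at a)"
    for \<xi> :: "nat \<Rightarrow> nat"
  proof -
    have "(\<lambda>s. (\<Prod>j\<in>A. (x(i := s)) j ^ \<xi> j * (1 - (x(i := s)) j) ^ (1 - \<xi> j))) differentiable (at a)"
      if "finite A" for A
      using that
    proof (induction A)
      case empty
      show ?case by simp
    next
      case (insert k A)
      have "(\<lambda>s. (x(i := s)) k) differentiable (at a)"
        by (cases "k = i") auto
      then show ?case
        using insert by (simp del: fun_upd_apply) 
    qed
    then show ?thesis by blast
  qed
  moreover have "finite (binary_cube n)"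
    by (simp add: binary_cube_def finite_PiE)
  ultimately show ?thesis
    unfolding multilinear_ext_def by (intro differentiable_sum differentiable_mult) auto
qed

lemma partial_lagrangian_interior:
  assumes "binarity_constraint g" "i \<in> {1..n}" "0 < x i" "x i < 1"
  shows "partial_lagrangian n F g i x y = ereal (partial_deriv (\<lambda>x. lagrangian n F g x y) i x)"
proof -
  let ?f = "\<lambda>s. multilinear_ext n F (x(i := s))"
  have f: "(?f has_field_derivative deriv ?f (x i)) (at (x i))"
    using multilinear_ext_differentiable[of n F x i "x i"]
    by (simp add: DERIV_deriv_iff_real_differentiable)
  have g: "(g has_field_derivative deriv g (x i)) (at (x i))"
    using assms by (simp add: binarity_constraint_def DERIV_deriv_iff_real_differentiable)
  have split: "(\<Sum>j=1..n. y j * g ((x(i := s)) j)) = y i * g s + (\<Sum>j\<in>{1..n} - {i}. y j * g (x j))" for s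
  proof -
    have "(\<Sum>j=1..n. y j * g ((x(i := s)) j)) =
        y i * g ((x(i := s)) i) + (\<Sum>j\<in>{1..n} - {i}. y j * g ((x(i := s)) j))"
      using assms(2) by (intro sum.remove) auto
    then show ?thesis by simp
  qed
  have "((\<lambda>s. ?f s + (y i * g s + (\<Sum>j\<in>{1..n} - {i}. y j * g (x j)))) has_field_derivative
      deriv ?f (x i) + y i * deriv g (x i)) (at (x i))"
    by (auto intro!: derivative_eq_intros f g)
  then have "partial_deriv (\<lambda>x. lagrangian n F g x y) i x = deriv ?f (x i) + y i * deriv g (x i)"
    unfolding partial_deriv_def lagrangian_def split by (rule DERIV_imp_deriv)
  then show ?thesis
    using assms by (simp add: partial_lagrangian_def partial_deriv_def ext_deriv_def)
qed

end

theory Submission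
  imports Defs
begin

text \<open>Convexity puts \<open>g\<close> below the chord between its two zero endpoint
  values.\<close>

lemma binarity_constraint_nonpos:
  assumes "binarity_constraint g" "s \<in> {0..1}"
  shows "g s \<le> 0"
proof -
  have "convex_on {0..1} g" "g 0 = 0" "g 1 = 0"
    using assms(1) by (auto simp: binarity_constraint_def)
  then show ?thesis
    using convex_onD[of "{0..1}" g s 0 1] assms(2) by simp
qed

text \<open>Clamping happens in \<open>ereal\<close> before the conversion, so the default value of
  \<open>real_of_ereal\<close> at infinity never enters.\<close>

lemma proj01_in_unit_interval: "proj01 z \<in> {0..1}"
  by (cases z) (auto simp: proj01_def max_def min_def zero_ereal_def one_ereal_def)

text \<open>Each branch of the update lands in [0,1] whatever the previous iterate was, so a case
  split on \<open>t\<close> replaces induction: one branch by projection, the other because 0 <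
  \<delta> < 1/2.\<close>

lemma pdbo_iterates_in_unit_cube:
  assumes "pdbo_iterates n F g \<alpha> \<beta> \<delta> x y" "x 0 \<in> unit_cube n" "0 < \<delta>" "\<delta> < 1/2"
  shows "x t \<in> unit_cube n"
proof (cases t)
  case 0
  then show ?thesis using assms(2) by simp
next
  case (Suc s)
  have "x (Suc s) i \<in> {0..1}" if "i \<in> {1..n}" for i
  proof -
    have "x (Suc s) i \<in> {1/2 - \<delta>, 1/2 + \<delta>} \<union> range proj01"
      using assms(1) that unfolding pdbo_iterates_def by (simp split: if_splits)
    then show ?thesis
      using assms(3,4) proj01_in_unit_interval by auto
  qed
  then show ?thesis using Suc by (simp add: unit_cube_def)
qed

lemma pdbo_iterates_dual_telescope:
  assumes "pdbo_iterates n F g \<alpha> \<beta> \<delta> x y" "i \<in> {1..n}"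
  shows "\<beta> * (\<Sum>t<T. - g (x t i)) = y 0 i - y T i"
  using assms by (induction T) (auto simp: pdbo_iterates_def algebra_simps)

text \<open>Since \<open>g\<close> is nonpositive on the cube, each dual coordinate is nonincreasing
  and so stays above its limit. This makes the telescoped sums bounded uniformly in the
  horizon.\<close>

lemma pdbo_iterates_dual_ge_limit:
  assumes "pdbo_iterates n F g \<alpha> \<beta> \<delta> x y" "binarity_constraint g" "x 0 \<in> unit_cube n"
    and "0 < \<beta>" "0 < \<delta>" "\<delta> < 1/2" "i \<in> {1..n}" "(\<lambda>t. y t i) \<longlonglongrightarrow> l"
  shows "l \<le> y t i"
proof -
  have "y (Suc s) i \<le> y s i" for s
  proof -
    have "x s i \<in> {0..1}"
      using pdbo_iterates_in_unit_cube[OF assms(1,3,5,6), of s] assms(7) by (simp add: unit_cube_def)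
    then have "\<beta> * g (x s i) \<le> 0"
      using binarity_constraint_nonpos[OF assms(2)] assms(4) by (simp add: mult_le_0_iff)
    then show ?thesis using assms(1,7) by (simp add: pdbo_iterates_def)
  qed
  then have "decseq (\<lambda>t. y t i)" by (rule decseq_SucI)
  then show ?thesis using assms(8) by (rule decseq_ge)
qed

text \<open>The dual update accumulates the binarity gaps, so the gaps of all iterates sum to at most
  \<open>\<parallel>y\<^sup>0 - y\<^sup>*\<parallel>\<^sub>1 / \<beta>\<close>, which leaves room for fewer than \<open>\<parallel>y\<^sup>0 - y\<^sup>*\<parallel>\<^sub>1 / (\<beta>\<epsilon>)\<close> gaps
  above \<open>\<epsilon>\<close>. Hence \<open>C = 1\<close> suffices.\<close>

theorem theorem3p7:
  "\<exists>C::real. C > 0 \<and>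
     (\<forall>(n::nat) (F :: (nat \<Rightarrow> nat) \<Rightarrow> real) (g :: real \<Rightarrow> real) (\<alpha>::real) (\<beta>::real) (\<delta>::real)
        (x :: nat \<Rightarrow> nat \<Rightarrow> real) (y :: nat \<Rightarrow> nat \<Rightarrow> real) (ystar :: nat \<Rightarrow> real) (\<epsilon>::real).
        binarity_constraint g \<and> \<alpha> > 0 \<and> \<beta> > 0 \<and> 0 < \<delta> \<and> \<delta> < 1/2 \<and>
        x 0 \<in> unit_cube n \<and> (\<forall>i\<in>{1..n}. y 0 i > 0) \<and>
        pdbo_iterates n F g \<alpha> \<beta> \<delta> x y \<and>
        (\<forall>i\<in>{1..n}. (\<lambda>t. y t i) \<longlonglongrightarrow> ystar i) \<and> \<epsilon> > 0
        \<longrightarrow> (\<exists>t::nat. real t \<le> C * ((\<Sum>i=1..n. \<bar>y 0 i - ystar i\<bar>) / (\<beta> * \<epsilon>)) \<and>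
               eps_binary n g \<epsilon> (x t)))"
proof (rule exI[of _ 1], intro conjI allI impI; (elim conjE)?)
  fix n F g \<alpha> \<beta> \<delta> and x y :: "nat \<Rightarrow> nat \<Rightarrow> real" and ystar :: "nat \<Rightarrow> real" and \<epsilon> :: real
  assume g: "binarity_constraint g" and \<beta>: "\<beta> > 0" and \<delta>: "0 < \<delta>" "\<delta> < 1/2"
    and x0: "x 0 \<in> unit_cube n" and iter: "pdbo_iterates n F g \<alpha> \<beta> \<delta> x y"
    and lim: "\<forall>i\<in>{1..n}. (\<lambda>t. y t i) \<longlonglongrightarrow> ystar i" and \<epsilon>: "\<epsilon> > 0"
  define D where "D = (\<Sum>i=1..n. \<bar>y 0 i - ystar i\<bar>)"
  \<comment> \<open>\<open>K\<close> is the largest index that the claimed bound admits. Indices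
    start at 0, so \<open>Suc K\<close> iterates are available.\<close>
  define K where "K = nat \<lfloor>D / (\<beta> * \<epsilon>)\<rfloor>"
  have "D / (\<beta> * \<epsilon>) \<ge> 0"
    using \<beta> \<epsilon> by (simp add: D_def sum_nonneg)
  then have K: "real K \<le> D / (\<beta> * \<epsilon>)" "D / (\<beta> * \<epsilon>) < real (Suc K)"
    unfolding K_def by linarith+
  have "\<exists>t\<le>K. eps_binary n g \<epsilon> (x t)"
  proof (rule ccontr)
    assume "\<not> ?thesis"
    \<comment> \<open>Membership in the cube is known, so \<open>eps_binary\<close> can only fail
      through the gap. The strict inequality needed later comes from \<open>K(2)\<close>.\<close>
    then have gap: "\<epsilon> \<le> (\<Sum>i=1..n. - g (x t i))" if "t < Suc K" for t
      using that pdbo_iterates_in_unit_cube[OF iter x0 \<delta>, of t]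
      by (force simp: eps_binary_def sum_negf)
    have "\<beta> * (real (Suc K) * \<epsilon>) \<le> \<beta> * (\<Sum>t<Suc K. \<Sum>i=1..n. - g (x t i))"
      using \<beta> sum_bounded_below[of "{..<Suc K}" \<epsilon> "\<lambda>t. \<Sum>i=1..n. - g (x t i)"] gap
      by (intro mult_left_mono) auto
    \<comment> \<open>With time as the inner sum, the dual update telescopes in each
      coordinate.\<close>
    also have "\<dots> = (\<Sum>i=1..n. \<beta> * (\<Sum>t<Suc K. - g (x t i)))"
      by (subst sum.swap) (simp only: sum_distrib_left)
    also have "\<dots> = (\<Sum>i=1..n. y 0 i - y (Suc K) i)"
      by (intro sum.cong refl pdbo_iterates_dual_telescope[OF iter])
    also have "\<dots> \<le> D"
      unfolding D_def
    proof (rule sum_mono)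
      fix i assume i: "i \<in> {1..n}"
      then have "ystar i \<le> y (Suc K) i"
        using lim by (intro pdbo_iterates_dual_ge_limit[OF iter g x0 \<beta> \<delta>]) auto
      then show "y 0 i - y (Suc K) i \<le> \<bar>y 0 i - ystar i\<bar>" by linarith
    qed
    \<comment> \<open>The chain gives \<beta> * \<open>Suc K\<close> * \<epsilon> \<le>
      \<open>D\<close>, against \<open>K(2)\<close>.\<close>
    finally show False
      using K(2) \<beta> \<epsilon> by (simp add: field_simps)
  qed
  then show "\<exists>t. real t \<le> 1 * ((\<Sum>i=1..n. \<bar>y 0 i - ystar i\<bar>) / (\<beta> * \<epsilon>)) \<and> eps_binary n g \<epsilon> (x t)"
    using K(1) unfolding D_def by (metis mult_1 of_nat_le_iff order_trans)
qed simp

end
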